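(* Let $G$ be a connected graph with vertex set $\{1,\dots,n\}$, $n\ge 2$, let $\Phi=(F_1,\dots,F_n)$ be an $n$-tuple of pairwise disjoint graphs with $\delta(F_i)=0$ and $|V(F_i)|\ge 2$ for all $i$, and let $G[\Phi]$ be the generalized lexicographic product. Then $G[\Phi]$ is well $\gamma_t$-dominated if and only if $G$ is well $\gamma_t$-dominated.
   Context: All graphs are finite, simple and undirected; $\delta(H)$ is the minimum degree. The generalized lexicographic product $G[\Phi]$ is the graph with vertex set $\bigcup_{i=1}^n V(F_i)$ in which each $F_i$ is an induced subgraph, and for $x\in V(F_i)$, $y\in V(F_j)$ with $i\neq j$, $xy$ is an edge iff $ij\in E(G)$. A total dominating set of $H$ is a set $S$ such that every vertex of $H$ has a neighbor in $S$; it is minimal if no proper subset is total dominating. $\gamma_t(H)$ is the minimum and $\Gamma_t(H)$ the maximum cardinality of a minimal total dominating set; $H$ is well $\gamma_t$-dominated if $\gamma_t(H)=\Gamma_t(H)$. *)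

theory Defs
  imports "Graph_Theory.Digraph_Component" "HOL-Library.Disjoint_Sets"
begin

text \<open>
  A finite simple undirected graph is a \<^locale>\<open>pair_graph\<close>: finitely many vertices and a
  symmetric, loop-free set of ordered pairs, the edge \<open>uv\<close> being the two pairs
  \<open>(u, v)\<close> and \<open>(v, u)\<close>. Hence the degree of a vertex is its out-degree.
\<close>

definition min_degree :: "'a pair_pre_digraph \<Rightarrow> nat" where
  "min_degree H = Min (out_degree (with_proj H) ` pverts H)"

text \<open>The vertices of \<open>G\<close> index the family \<open>\<Phi>\<close>; values of \<open>\<Phi>\<close> elsewhere are irrelevant.\<close>

definition gen_lex_prod ::
    "'i pair_pre_digraph \<Rightarrow> ('i \<Rightarrow> 'a pair_pre_digraph) \<Rightarrow> 'a pair_pre_digraph" where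
  "gen_lex_prod G \<Phi> =
    \<lparr> pverts = (\<Union>i\<in>pverts G. pverts (\<Phi> i)),
      parcs = (\<Union>i\<in>pverts G. parcs (\<Phi> i)) \<union>
        {(x, y). \<exists>i\<in>pverts G. \<exists>j\<in>pverts G. i \<noteq> j \<and> x \<in> pverts (\<Phi> i) \<and> y \<in> pverts (\<Phi> j)
          \<and> (i, j) \<in> parcs G} \<rparr>"

definition total_dominating :: "'a pair_pre_digraph \<Rightarrow> 'a set \<Rightarrow> bool" where
  "total_dominating H S \<longleftrightarrow> S \<subseteq> pverts H \<and> (\<forall>v\<in>pverts H. \<exists>u\<in>S. (v, u) \<in> parcs H)"

definition minimal_total_dominating :: "'a pair_pre_digraph \<Rightarrow> 'a set \<Rightarrow> bool" where
  "minimal_total_dominating H S \<longleftrightarrow>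
    total_dominating H S \<and> (\<forall>T. T \<subset> S \<longrightarrow> \<not> total_dominating H T)"

text \<open>
  Both parameters are meaningful only if \<open>H\<close> has a total dominating set, that is, no isolated
  vertex; otherwise \<^const>\<open>Min\<close> and \<^const>\<open>Max\<close> are applied to the empty set.
\<close>

definition lower_total_dom :: "'a pair_pre_digraph \<Rightarrow> nat" (\<open>\<gamma>\<^sub>t\<close>) where
  "\<gamma>\<^sub>t H = Min (card ` {S. minimal_total_dominating H S})"

definition upper_total_dom :: "'a pair_pre_digraph \<Rightarrow> nat" (\<open>\<Gamma>\<^sub>t\<close>) where
  "\<Gamma>\<^sub>t H = Max (card ` {S. minimal_total_dominating H S})"

definition well_total_dominated :: "'a pair_pre_digraph \<Rightarrow> bool" where
  "well_total_dominated H \<longleftrightarrow> \<gamma>\<^sub>t H = \<Gamma>\<^sub>t H"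


lemma pair_graph_gen_lex_prod:
  assumes "pair_graph G" and "\<And>i. i \<in> pverts G \<Longrightarrow> pair_graph (\<Phi> i)"
    and disj: "disjoint_family_on (\<lambda>i. pverts (\<Phi> i)) (pverts G)"
  shows "pair_graph (gen_lex_prod G \<Phi>)"
proof -
  interpret G: pair_graph G by fact
  let ?H = "gen_lex_prod G \<Phi>"
  have wf: "u \<in> pverts (\<Phi> i) \<and> v \<in> pverts (\<Phi> i) \<and> u \<noteq> v \<and> (v, u) \<in> parcs (\<Phi> i)"
    if "i \<in> pverts G" "(u, v) \<in> parcs (\<Phi> i)" for i u v
  proof -
    interpret F: pair_graph "\<Phi> i" using assms that by blast
    show ?thesis
      using F.wellformed' F.no_loops' F.pair_sym_arcs that(2)
      by (auto simp: symmetric_def dest: symD)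
  qed
  have sym: "(j, i) \<in> parcs G" if "(i, j) \<in> parcs G" for i j
    using G.pair_sym_arcs that by (auto simp: symmetric_def dest: symD)
  have fin: "finite (pverts ?H)"
    using G.pair_finite_verts assms(2)
    by (auto simp: gen_lex_prod_def pair_graph_def pair_digraph_def pair_fin_digraph_def
        pair_fin_digraph_axioms_def)
  have arcs: "u \<in> pverts ?H \<and> v \<in> pverts ?H \<and> u \<noteq> v \<and> (v, u) \<in> parcs ?H"
    if "(u, v) \<in> parcs ?H" for u v
  proof -
    from that consider
        (inner) i where "i \<in> pverts G" "(u, v) \<in> parcs (\<Phi> i)"
      | (outer) i j where "i \<in> pverts G" "j \<in> pverts G" "i \<noteq> j" "u \<in> pverts (\<Phi> i)"
          "v \<in> pverts (\<Phi> j)" "(i, j) \<in> parcs G"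
      by (auto simp: gen_lex_prod_def)
    then show ?thesis
    proof cases
      case inner
      then show ?thesis using wf[OF inner] by (auto simp: gen_lex_prod_def)
    next
      case outer
      then have "u \<noteq> v" using disj by (auto simp: disjoint_family_on_def)
      moreover have "(v, u) \<in> parcs ?H"
        using outer(1-5) sym[OF outer(6)] by (fastforce simp: gen_lex_prod_def)
      ultimately show ?thesis using outer(1,2,4,5) by (auto simp: gen_lex_prod_def)
    qed
  qed
  have "finite (parcs ?H)"
    by (rule finite_subset[of _ "pverts ?H \<times> pverts ?H"]) (use fin arcs in auto)
  then show ?thesis
    using fin arcs by unfold_locales (auto simp: symmetric_def intro!: symI)
qed

lemma induced_subgraph_gen_lex_prod:
  assumes "pair_graph G" and "\<And>i. i \<in> pverts G \<Longrightarrow> pair_graph (\<Phi> i)"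
    and disj: "disjoint_family_on (\<lambda>i. pverts (\<Phi> i)) (pverts G)"
    and i: "i \<in> pverts G"
  shows "induced_subgraph (with_proj (\<Phi> i)) (with_proj (gen_lex_prod G \<Phi>))"
proof -
  let ?H = "gen_lex_prod G \<Phi>"
  interpret H: pair_graph ?H using assms by (intro pair_graph_gen_lex_prod)
  interpret F: pair_graph "\<Phi> i" using assms by blast
  have wf: "u \<in> pverts (\<Phi> j) \<and> v \<in> pverts (\<Phi> j)"
    if "j \<in> pverts G" "(u, v) \<in> parcs (\<Phi> j)" for j u v
  proof -
    interpret Fj: pair_graph "\<Phi> j" using assms that by blast
    show ?thesis using Fj.wellformed' that(2) by blast
  qed
  have eq: "j = k" if "x \<in> pverts (\<Phi> j)" "x \<in> pverts (\<Phi> k)" "j \<in> pverts G" "k \<in> pverts G" for j k x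
    using disj that unfolding disjoint_family_on_def by blast
  have "(u, v) \<in> parcs (\<Phi> i) \<longleftrightarrow>
      (u, v) \<in> parcs ?H \<and> u \<in> pverts (\<Phi> i) \<and> v \<in> pverts (\<Phi> i)" for u v
  proof (intro iffI conjI; (elim conjE)?)
    assume uv: "(u, v) \<in> parcs (\<Phi> i)"
    show "(u, v) \<in> parcs ?H" using uv i by (auto simp: gen_lex_prod_def)
    show "u \<in> pverts (\<Phi> i)" "v \<in> pverts (\<Phi> i)" using wf[OF i uv] by auto
  next
    assume uv: "(u, v) \<in> parcs ?H" "u \<in> pverts (\<Phi> i)" "v \<in> pverts (\<Phi> i)"
    from uv(1) consider
        (inner) j where "j \<in> pverts G" "(u, v) \<in> parcs (\<Phi> j)"
      | (outer) j k where "j \<in> pverts G" "k \<in> pverts G" "j \<noteq> k" "u \<in> pverts (\<Phi> j)"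
          "v \<in> pverts (\<Phi> k)"
      by (auto simp: gen_lex_prod_def)
    then show "(u, v) \<in> parcs (\<Phi> i)"
    proof cases
      case inner
      then have "j = i" using eq[of u j i] wf[OF inner] uv i by blast
      then show ?thesis using inner by simp
    next
      case outer
      then show ?thesis using eq[of u j i] eq[of v k i] uv i by blast
    qed
  qed
  moreover have "pverts (\<Phi> i) \<subseteq> pverts ?H"
    using i by (auto simp: gen_lex_prod_def)
  ultimately show ?thesis
    using H.wf_digraph F.wf_digraph
    by (auto simp: induced_subgraph_def subgraph_def compatible_def)
qed

lemma ex_minimal_total_dominating:
  assumes "pair_graph H" and "\<And>v. v \<in> pverts H \<Longrightarrow> \<exists>u. (v, u) \<in> parcs H"
  shows "\<exists>S. minimal_total_dominating H S"
proof -
  interpret H: pair_graph H by fact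
  let ?A = "{S. total_dominating H S}"
  have "finite ?A"
    by (rule finite_subset[of _ "Pow (pverts H)"])
      (auto simp: total_dominating_def H.pair_finite_verts)
  moreover have "pverts H \<in> ?A"
    using assms(2) H.wellformed' by (fastforce simp: total_dominating_def)
  ultimately obtain S where "S \<in> ?A" "\<forall>T\<in>?A. T \<subseteq> S \<longrightarrow> S = T"
    using finite_has_minimal[of ?A] by blast
  then show ?thesis by (auto simp: minimal_total_dominating_def)
qed

end

theory Submission
  imports Defs
begin

text \<open>
  Every fibre \<open>F\<^sub>i\<close> has an isolated vertex, and in \<open>G[\<Phi>]\<close> the neighbours of that vertex are exactly
  the vertices of the fibres over the neighbours of \<open>i\<close>. So a set of vertices of \<open>G[\<Phi>]\<close> is total
  dominating if and only if its projection to \<open>G\<close> is. When membership in a family of sets depends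
  only on the image under a map \<open>f\<close>, its minimal members are the sets on which \<open>f\<close> is injective and
  whose image is minimal. Hence the minimal total dominating sets of \<open>G[\<Phi>]\<close> and of \<open>G\<close> have the same
  cardinalities.
\<close>

definition inclusion_minimal :: "('a set \<Rightarrow> bool) \<Rightarrow> 'a set \<Rightarrow> bool" where
  "inclusion_minimal P S \<longleftrightarrow> P S \<and> (\<forall>T. T \<subset> S \<longrightarrow> \<not> P T)"

lemma inclusion_minimalD:
  assumes "inclusion_minimal P S"
  shows "P S" and "T \<subseteq> S \<Longrightarrow> P T \<Longrightarrow> T = S"
  using assms by (auto simp: inclusion_minimal_def)

lemma inclusion_minimal_image_iff:
  assumes P_iff: "\<And>T. T \<subseteq> S \<Longrightarrow> P T \<longleftrightarrow> Q (f ` T)"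
  shows "inclusion_minimal P S \<longleftrightarrow> inj_on f S \<and> inclusion_minimal Q (f ` S)"
proof
  assume min_S: "inclusion_minimal P S"
  have Q_image: "Q (f ` S)"
    using inclusion_minimalD(1)[OF min_S] P_iff by simp
  obtain T where transversal: "T \<subseteq> S" "inj_on f T" "f ` S = f ` T"
    using subset_image_inj[of "f ` S" f S] by blast
  with Q_image have "T = S"
    by (intro inclusion_minimalD(2)[OF min_S]) (simp_all add: P_iff)
  with transversal have "inj_on f S" by simp
  moreover have "\<not> Q D" if smaller: "D \<subset> f ` S" for D
  proof
    assume "Q D"
    obtain T where lift: "T \<subseteq> S" "D = f ` T"
      using smaller subset_imageE[of D f S] by blast
    with \<open>Q D\<close> have "T = S"
      by (intro inclusion_minimalD(2)[OF min_S]) (simp_all add: P_iff)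
    with lift smaller show False by simp
  qed
  ultimately show "inj_on f S \<and> inclusion_minimal Q (f ` S)"
    using Q_image by (simp add: inclusion_minimal_def)
next
  assume "inj_on f S \<and> inclusion_minimal Q (f ` S)"
  then have inj: "inj_on f S" and min_image: "inclusion_minimal Q (f ` S)" by auto
  have "\<not> P T" if "T \<subset> S" for T
    using image_strict_mono[OF inj that] min_image P_iff[of T] that
    by (auto simp: inclusion_minimal_def)
  then show "inclusion_minimal P S"
    using inclusion_minimalD(1)[OF min_image] P_iff by (simp add: inclusion_minimal_def)
qed

lemma card_inclusion_minimal_image_eq:
  assumes P_subset: "\<And>S. P S \<Longrightarrow> S \<subseteq> A"
    and Q_subset: "\<And>D. Q D \<Longrightarrow> D \<subseteq> f ` A"
    and P_iff: "\<And>S. S \<subseteq> A \<Longrightarrow> P S \<longleftrightarrow> Q (f ` S)"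
  shows "card ` {S. inclusion_minimal P S} = card ` {D. inclusion_minimal Q D}"
proof -
  have minimal_iff: "inclusion_minimal P S \<longleftrightarrow> inj_on f S \<and> inclusion_minimal Q (f ` S)"
    if "S \<subseteq> A" for S
    using that P_iff by (intro inclusion_minimal_image_iff) simp
  show ?thesis
  proof (intro equalityI image_subsetI; elim CollectE)
    fix S assume min_S: "inclusion_minimal P S"
    have "S \<subseteq> A" using P_subset[OF inclusion_minimalD(1)[OF min_S]] .
    with min_S have "inj_on f S" "inclusion_minimal Q (f ` S)"
      by (simp_all add: minimal_iff)
    then show "card S \<in> card ` {D. inclusion_minimal Q D}"
      by (intro image_eqI[where x = "f ` S"]) (simp_all add: card_image)
  next
    fix D assume min_D: "inclusion_minimal Q D"
    have "D \<subseteq> f ` A" using Q_subset[OF inclusion_minimalD(1)[OF min_D]] .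
    then obtain S where transversal: "S \<subseteq> A" "inj_on f S" "D = f ` S"
      by (auto simp: subset_image_inj)
    with min_D have "inclusion_minimal P S"
      by (simp add: minimal_iff)
    with transversal show "card D \<in> card ` {S. inclusion_minimal P S}"
      by (intro image_eqI[where x = S]) (simp_all add: card_image)
  qed
qed

lemma minimal_total_dominating_eq_inclusion_minimal:
  "minimal_total_dominating H = inclusion_minimal (total_dominating H)"
  by (simp add: fun_eq_iff minimal_total_dominating_def inclusion_minimal_def)

definition isolated_vertex :: "'a pair_pre_digraph \<Rightarrow> 'a \<Rightarrow> bool" where
  "isolated_vertex F z \<longleftrightarrow> z \<in> pverts F \<and> (\<forall>u. (z, u) \<notin> parcs F)"

lemma (in pair_fin_digraph) isolated_vertex_iff_out_degree_0:
  "isolated_vertex G z \<longleftrightarrow> z \<in> pverts G \<and> out_degree (with_proj G) z = 0"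
  using finite_out_arcs[of z]
  by (auto simp: isolated_vertex_def out_degree_def out_arcs_def)

lemma (in pair_fin_digraph) min_degree_eq_0_iff_ex_isolated_vertex:
  assumes "pverts G \<noteq> {}"
  shows "min_degree G = 0 \<longleftrightarrow> (\<exists>z. isolated_vertex G z)"
proof -
  have "min_degree G = 0 \<longleftrightarrow> (\<exists>z\<in>pverts G. out_degree (with_proj G) z = 0)"
    using assms pair_finite_verts by (auto simp: min_degree_def Min_eq_iff)
  then show ?thesis
    by (auto simp: isolated_vertex_iff_out_degree_0)
qed

locale gen_lex_product = pair_loopfree_digraph G for G :: "'i pair_pre_digraph" +
  fixes \<Phi> :: "'i \<Rightarrow> 'a pair_pre_digraph"
  assumes pair_wf_digraph_fibre: "i \<in> pverts G \<Longrightarrow> pair_wf_digraph (\<Phi> i)"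
    and disjoint_fibres: "disjoint_family_on (\<lambda>i. pverts (\<Phi> i)) (pverts G)"
begin

abbreviation "product \<equiv> gen_lex_prod G \<Phi>"

definition proj :: "'a \<Rightarrow> 'i" where
  "proj x = (THE i. i \<in> pverts G \<and> x \<in> pverts (\<Phi> i))"

lemma proj_eq:
  assumes "i \<in> pverts G" and "x \<in> pverts (\<Phi> i)"
  shows "proj x = i"
  unfolding proj_def using assms disjoint_fibres
  by (intro the_equality) (auto simp: disjoint_family_on_def)

lemma in_pverts_product_iff:
  "x \<in> pverts product \<longleftrightarrow> proj x \<in> pverts G \<and> x \<in> pverts (\<Phi> (proj x))"
  by (auto simp: gen_lex_prod_def proj_eq)

lemma proj_image_subset: "S \<subseteq> pverts product \<Longrightarrow> proj ` S \<subseteq> pverts G"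
  by (auto simp: in_pverts_product_iff)

lemma in_parcs_product_iff:
  assumes x: "x \<in> pverts product" and y: "y \<in> pverts product"
  shows "(x, y) \<in> parcs product \<longleftrightarrow>
    (x, y) \<in> parcs (\<Phi> (proj x)) \<or> (proj x, proj y) \<in> parcs G"
proof
  assume "(x, y) \<in> parcs product"
  then consider (inner) i where "i \<in> pverts G" "(x, y) \<in> parcs (\<Phi> i)"
    | (outer) i j where "i \<in> pverts G" "j \<in> pverts G" "x \<in> pverts (\<Phi> i)"
        "y \<in> pverts (\<Phi> j)" "(i, j) \<in> parcs G"
    by (auto simp: gen_lex_prod_def)
  then show "(x, y) \<in> parcs (\<Phi> (proj x)) \<or> (proj x, proj y) \<in> parcs G"
  proof cases
    case inner
    then interpret F: pair_wf_digraph "\<Phi> i" by (intro pair_wf_digraph_fibre)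
    have "proj x = i" using inner F.in_arcsD1 by (intro proj_eq) auto
    with inner show ?thesis by simp
  next
    case outer
    then show ?thesis by (simp add: proj_eq)
  qed
next
  have fibres: "proj x \<in> pverts G" "x \<in> pverts (\<Phi> (proj x))"
      "proj y \<in> pverts G" "y \<in> pverts (\<Phi> (proj y))"
    using x y by (simp_all add: in_pverts_product_iff)
  assume "(x, y) \<in> parcs (\<Phi> (proj x)) \<or> (proj x, proj y) \<in> parcs G"
  then show "(x, y) \<in> parcs product"
  proof
    assume "(x, y) \<in> parcs (\<Phi> (proj x))"
    with fibres show ?thesis by (auto simp: gen_lex_prod_def)
  next
    assume "(proj x, proj y) \<in> parcs G"
    moreover from this have "proj x \<noteq> proj y" by (rule no_loops')
    ultimately show ?thesis using fibres by (auto simp: gen_lex_prod_def)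
  qed
qed

lemma total_dominating_product_if_proj:
  assumes S_subset: "S \<subseteq> pverts product" and dom: "total_dominating G (proj ` S)"
  shows "total_dominating product S"
proof -
  have "\<exists>u\<in>S. (v, u) \<in> parcs product" if v: "v \<in> pverts product" for v
  proof -
    have "proj v \<in> pverts G" using v by (simp add: in_pverts_product_iff)
    then obtain u where "u \<in> S" "(proj v, proj u) \<in> parcs G"
      using dom by (auto simp: total_dominating_def)
    then show ?thesis using in_parcs_product_iff[OF v] S_subset by blast
  qed
  with S_subset show ?thesis by (simp add: total_dominating_def)
qed

context
  assumes ex_isolated_vertex: "i \<in> pverts G \<Longrightarrow> \<exists>z. isolated_vertex (\<Phi> i) z"
begin

lemma total_dominating_proj_if_product:
  assumes dom: "total_dominating product S"
  shows "total_dominating G (proj ` S)"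
proof -
  have S_subset: "S \<subseteq> pverts product" using dom by (simp add: total_dominating_def)
  have "\<exists>j\<in>proj ` S. (i, j) \<in> parcs G" if i: "i \<in> pverts G" for i
  proof -
    obtain z where isolated: "isolated_vertex (\<Phi> i) z"
      using ex_isolated_vertex[OF i] by blast
    then have proj_z: "proj z = i"
      using i by (auto simp: isolated_vertex_def intro: proj_eq)
    have z_in_product: "z \<in> pverts product"
      using i isolated proj_z by (simp add: in_pverts_product_iff isolated_vertex_def)
    then obtain u where u: "u \<in> S" "(z, u) \<in> parcs product"
      using dom by (auto simp: total_dominating_def)
    then have "(i, proj u) \<in> parcs G"
      using in_parcs_product_iff[OF z_in_product, of u] S_subset isolated proj_z
      by (auto simp: isolated_vertex_def)
    with u(1) show ?thesis by blast
  qed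
  with proj_image_subset[OF S_subset] show ?thesis by (simp add: total_dominating_def)
qed

lemma proj_image_pverts_product: "proj ` pverts product = pverts G"
proof
  show "pverts G \<subseteq> proj ` pverts product"
  proof
    fix i assume i: "i \<in> pverts G"
    then obtain z where "z \<in> pverts (\<Phi> i)"
      using ex_isolated_vertex by (auto simp: isolated_vertex_def)
    with i show "i \<in> proj ` pverts product"
      by (intro image_eqI[where x = z]) (simp_all add: proj_eq in_pverts_product_iff)
  qed
qed (simp add: proj_image_subset)

lemma card_minimal_total_dominating_product:
  "card ` {S. minimal_total_dominating product S} = card ` {D. minimal_total_dominating G D}"
  unfolding minimal_total_dominating_eq_inclusion_minimal
proof (rule card_inclusion_minimal_image_eq[where f = proj and A = "pverts product"])
  show "D \<subseteq> proj ` pverts product" if "total_dominating G D" for D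
    using that by (simp add: total_dominating_def proj_image_pverts_product)
  show "total_dominating product S \<longleftrightarrow> total_dominating G (proj ` S)"
    if "S \<subseteq> pverts product" for S
    using that total_dominating_product_if_proj total_dominating_proj_if_product by blast
qed (simp add: total_dominating_def)

lemma lower_total_dom_product: "\<gamma>\<^sub>t product = \<gamma>\<^sub>t G"
  by (simp add: lower_total_dom_def card_minimal_total_dominating_product)

lemma upper_total_dom_product: "\<Gamma>\<^sub>t product = \<Gamma>\<^sub>t G"
  by (simp add: upper_total_dom_def card_minimal_total_dominating_product)

end

end

theorem theorem3p11:
  fixes n :: nat
    and G :: "nat pair_pre_digraph"
    and \<Phi> :: "nat \<Rightarrow> 'a pair_pre_digraph"
  assumes "n \<ge> 2"
    and "pair_graph G"
    and "pverts G = {1..n}"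
    and "Digraph_Component.connected (with_proj G)"
    and "\<And>i. i \<in> {1..n} \<Longrightarrow> pair_graph (\<Phi> i)"
    and "disjoint_family_on (\<lambda>i. pverts (\<Phi> i)) {1..n}"
    and "\<And>i. i \<in> {1..n} \<Longrightarrow> min_degree (\<Phi> i) = 0"
    and "\<And>i. i \<in> {1..n} \<Longrightarrow> card (pverts (\<Phi> i)) \<ge> 2"
  shows "well_total_dominated (gen_lex_prod G \<Phi>) \<longleftrightarrow> well_total_dominated G"
proof -
  interpret G: pair_graph G by fact
  have fibre: "pair_fin_digraph (\<Phi> i)" if "i \<in> pverts G" for i
    using that assms(3,5) by (simp add: pair_graph_def pair_digraph_def)
  interpret gen_lex_product G \<Phi>
  proof (intro gen_lex_product.intro gen_lex_product_axioms.intro)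
    show "pair_loopfree_digraph G" ..
    show "pair_wf_digraph (\<Phi> i)" if "i \<in> pverts G" for i
      using fibre[OF that] by (simp add: pair_fin_digraph_def)
    show "disjoint_family_on (\<lambda>i. pverts (\<Phi> i)) (pverts G)"
      using assms(3,6) by simp
  qed
  have "\<exists>z. isolated_vertex (\<Phi> i) z" if i: "i \<in> pverts G" for i
  proof -
    have "pverts (\<Phi> i) \<noteq> {}" using i assms(3) assms(8)[of i] by auto
    then show ?thesis
      using i assms(3,7) pair_fin_digraph.min_degree_eq_0_iff_ex_isolated_vertex[OF fibre] by simp
  qed
  then show ?thesis
    by (simp add: well_total_dominated_def lower_total_dom_product upper_total_dom_product)
qed

end
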